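(* Let the environment $(\Omega,\mathcal F,\mathbb P,\theta)$, the random transition probabilities $R_\omega$ and a random family of probability measures $\mu_\omega$ on $\mathcal X_\omega$ with $(R_\omega)^*\mu_\omega=\mu_{\theta\omega}$ ($\mathbb P$-a.s.) be as in the context. Let $p\ge1$ be finite and suppose that $\mathbb P$-a.s., for all $n\in\mathbb N$, $$\|R_{\omega,n}-\mu_{\theta^n\omega}\|_\infty\le K(\omega)\rho^{n/p},$$ where $K\in L^p(\Omega,\mathcal F,\mathbb P)$ and $\rho\in(0,1)$. For $\varepsilon>0$ define $$N_\varepsilon(\omega)=\min\{n\in\mathbb N:\ \|R_{\omega,n}-\mu_{\theta^n\omega}\|_\infty\le\varepsilon\}.$$ Then for every $\varepsilon>0$ and every $N\in\mathbb N$, $$\mathbb P(\omega: N_\varepsilon(\omega)>N)\le\|K\|_{L^p}^p\,\varepsilon^{-p}\rho^N.$$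
   Context: Here $\mathbb N=\{1,2,\dots\}$. Environment. $Y=(Y_j)_{j\in\mathbb Z}$ is a stationary ergodic sequence of random variables with values in a measurable space $\mathcal Y$. $(\Omega,\mathcal F,\mathbb P,\theta)$ is the associated shift system: $\Omega=\mathcal Y^{\mathbb Z}$, $\theta$ is the left shift, $\mathbb P$ is the law of $(Y_j)_{j\in\mathbb Z}$, and $\omega=(\omega_n)_{n\in\mathbb Z}$. Random Markov operators. $\mathcal X$ is a measurable space and $\mathcal X_\omega\subseteq\mathcal X$ are subsets, measurable in $\omega$ and depending only on $\omega_0$. $R_\omega(x,\Gamma)$ ($x\in\mathcal X_\omega$, $\Gamma\subseteq\mathcal X_{\theta\omega}$ measurable) are transition probabilities, measurable in $\omega$ and depending on $\omega$ only through $\omega_0$. We also view $R_\omega$ as the operator $R_\omega g(x)=\int g(y)R_\omega(x,dy)$ on bounded measurable $g:\mathcal X_{\theta\omega}\to\mathbb R$, and set $R_{\omega,n}=R_\omega\circ R_{\theta\omega}\circ\cdots\circ R_{\theta^{n-1}\omega}$. For a probability measure $\mu$ on $\mathcal X_\omega$, $(R_\omega)^*\mu$ is the measure $\Gamma\mapsto\int R_\omega(x,\Gamma)\,d\mu(x)$ on $\mathcal X_{\theta\omega}$. Norm. With $\|g\|_\infty=\sup|g|$, and for a probability measure $\mu$ on $\mathcal X_{\theta^n\omega}$ viewed as the operator $g\mapsto\mu(g)\mathbf 1$, $\|R_{\omega,n}-\mu\|_\infty=\sup_{\|g\|_\infty\le1}\|R_{\omega,n}g-\mu(g)\|_\infty$,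 the supremum being over bounded measurable $g$ on $\mathcal X_{\theta^n\omega}$. The functions $\omega\mapsto\|R_{\omega,n}-\mu_{\theta^n\omega}\|_\infty$ are understood to be measurable. *)

theory Defs
  imports "HOL-Probability.Probability"
begin

section \<open>The environment: two-sided stationary ergodic sequences\<close>

definition left_shift :: "(int \<Rightarrow> 'y) \<Rightarrow> (int \<Rightarrow> 'y)" where
  "left_shift \<omega> = (\<lambda>j. \<omega> (j + 1))"

definition sequence_law ::
    "'s measure \<Rightarrow> 'y measure \<Rightarrow> (int \<Rightarrow> 's \<Rightarrow> 'y) \<Rightarrow> (int \<Rightarrow> 'y) measure" where
  "sequence_law S MY Y = distr S (PiM UNIV (\<lambda>_. MY)) (\<lambda>s j. Y j s)"

definition stationary_sequence ::
    "'s measure \<Rightarrow> 'y measure \<Rightarrow> (int \<Rightarrow> 's \<Rightarrow> 'y) \<Rightarrow> bool" where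
  "stationary_sequence S MY Y \<longleftrightarrow>
     (\<forall>k. sequence_law S MY (\<lambda>j. Y (j + k)) = sequence_law S MY Y)"

definition ergodic_sequence ::
    "'s measure \<Rightarrow> 'y measure \<Rightarrow> (int \<Rightarrow> 's \<Rightarrow> 'y) \<Rightarrow> bool" where
  "ergodic_sequence S MY Y \<longleftrightarrow>
     (let P = sequence_law S MY Y in
      \<forall>A\<in>sets P. left_shift -` A \<inter> space P = A \<longrightarrow> measure P A = 0 \<or> measure P A = 1)"


section \<open>Random state spaces, transition probabilities and measures\<close>

text \<open>
  Throughout, \<open>P\<close> is the measure on two-sided sequences, \<open>MX\<close> the ambient measurable space, and
  \<open>X \<omega>\<close> carries the trace sigma-algebra \<open>restrict_space MX (X \<omega>)\<close>.
\<close>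

text \<open>
  Measurability in \<open>\<omega>\<close> of the random set means measurability of its graph in the product space;
  in particular each \<open>X \<omega>\<close> is a measurable subset of \<open>MX\<close>.
\<close>

definition random_state_space ::
    "(int \<Rightarrow> 'y) measure \<Rightarrow> 'x measure \<Rightarrow> ((int \<Rightarrow> 'y) \<Rightarrow> 'x set) \<Rightarrow> bool" where
  "random_state_space P MX X \<longleftrightarrow>
     (SIGMA \<omega>:space P. X \<omega>) \<in> sets (P \<Otimes>\<^sub>M MX) \<and>
     (\<forall>\<omega>\<in>space P. \<forall>\<omega>'\<in>space P. \<omega> 0 = \<omega>' 0 \<longrightarrow> X \<omega> = X \<omega>')"

text \<open>
  Since \<open>R \<omega> x\<close> lives on \<open>X (left_shift \<omega>)\<close>, which varies with \<open>\<omega>\<close>, measurability in \<open>\<omega>\<close> is expressed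
  through the traces \<open>\<Gamma> \<inter> X (left_shift \<omega>)\<close> of a fixed measurable \<open>\<Gamma>\<close>. For the same reason, the
  dependence of \<open>R \<omega> x\<close> on \<open>\<omega> 0\<close> only is required of the values \<open>R\<^sub>\<omega>(x, \<Gamma>)\<close> wherever both
  values are defined; equality as measures would force \<open>X (left_shift \<omega>)\<close> not to depend on \<open>\<omega> 1\<close>.
\<close>

definition random_transition ::
    "(int \<Rightarrow> 'y) measure \<Rightarrow> 'x measure \<Rightarrow> ((int \<Rightarrow> 'y) \<Rightarrow> 'x set) \<Rightarrow>
     ((int \<Rightarrow> 'y) \<Rightarrow> 'x \<Rightarrow> 'x measure) \<Rightarrow> bool" where
  "random_transition P MX X R \<longleftrightarrow>
     (\<forall>\<omega>\<in>space P. R \<omega> \<in> restrict_space MX (X \<omega>) \<rightarrow>\<^sub>M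
                        prob_algebra (restrict_space MX (X (left_shift \<omega>)))) \<and>
     (\<forall>x\<in>space MX. \<forall>\<Gamma>\<in>sets MX.
        (\<lambda>\<omega>. measure (R \<omega> x) (\<Gamma> \<inter> X (left_shift \<omega>)))
          \<in> borel_measurable (restrict_space P {\<omega>\<in>space P. x \<in> X \<omega>})) \<and>
     (\<forall>\<omega>\<in>space P. \<forall>\<omega>'\<in>space P. \<omega> 0 = \<omega>' 0 \<longrightarrow>
        (\<forall>x\<in>X \<omega>. \<forall>\<Gamma>\<in>sets MX. \<Gamma> \<subseteq> X (left_shift \<omega>) \<inter> X (left_shift \<omega>') \<longrightarrow>
           measure (R \<omega> x) \<Gamma> = measure (R \<omega>' x) \<Gamma>))"

definition random_probability ::
    "(int \<Rightarrow> 'y) measure \<Rightarrow> 'x measure \<Rightarrow> ((int \<Rightarrow> 'y) \<Rightarrow> 'x set) \<Rightarrow>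
     ((int \<Rightarrow> 'y) \<Rightarrow> 'x measure) \<Rightarrow> bool" where
  "random_probability P MX X \<mu> \<longleftrightarrow>
     (\<forall>\<omega>\<in>space P. \<mu> \<omega> \<in> space (prob_algebra (restrict_space MX (X \<omega>)))) \<and>
     (\<forall>\<Gamma>\<in>sets MX. (\<lambda>\<omega>. measure (\<mu> \<omega>) (\<Gamma> \<inter> X \<omega>)) \<in> borel_measurable P)"


section \<open>Markov operators and their distance to a measure\<close>

definition markov_op :: "('x \<Rightarrow> 'x measure) \<Rightarrow> ('x \<Rightarrow> real) \<Rightarrow> 'x \<Rightarrow> real" where
  "markov_op \<kappa> g x = (\<integral>y. g y \<partial>\<kappa> x)"

primrec markov_iter ::
    "((int \<Rightarrow> 'y) \<Rightarrow> 'x \<Rightarrow> 'x measure) \<Rightarrow> nat \<Rightarrow> (int \<Rightarrow> 'y) \<Rightarrow> ('x \<Rightarrow> real) \<Rightarrow> 'x \<Rightarrow> real" where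
  "markov_iter R 0 \<omega> = id"
| "markov_iter R (Suc n) \<omega> = markov_op (R \<omega>) \<circ> markov_iter R n (left_shift \<omega>)"

definition sup_norm :: "'x set \<Rightarrow> ('x \<Rightarrow> real) \<Rightarrow> real" where
  "sup_norm A g = (SUP x\<in>A. \<bar>g x\<bar>)"

definition bounded_measurable :: "'x measure \<Rightarrow> 'x set \<Rightarrow> ('x \<Rightarrow> real) set" where
  "bounded_measurable MX A = {g \<in> borel_measurable (restrict_space MX A). bounded (g ` A)}"

text \<open>
  \<open>\<parallel>R\<^sub>\<omega>\<^sub>,\<^sub>n - \<nu>\<parallel>\<^sub>\<infinity>\<close> for a probability measure \<open>\<nu>\<close> on \<open>X ((left_shift ^^ n) \<omega>)\<close>. The suprema are over
  nonempty sets bounded by 2 whenever \<open>X \<omega> \<noteq> {}\<close>, so real-valued suprema are adequate; the latter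
  holds as soon as \<open>X \<omega>\<close> carries a probability measure.
\<close>

definition markov_dist ::
    "'x measure \<Rightarrow> ((int \<Rightarrow> 'y) \<Rightarrow> 'x set) \<Rightarrow> ((int \<Rightarrow> 'y) \<Rightarrow> 'x \<Rightarrow> 'x measure) \<Rightarrow>
     nat \<Rightarrow> (int \<Rightarrow> 'y) \<Rightarrow> 'x measure \<Rightarrow> real" where
  "markov_dist MX X R n \<omega> \<nu> =
     (SUP g \<in> {g \<in> bounded_measurable MX (X ((left_shift ^^ n) \<omega>)).
                 sup_norm (X ((left_shift ^^ n) \<omega>)) g \<le> 1}.
        sup_norm (X \<omega>) (\<lambda>x. markov_iter R n \<omega> g x - (\<integral>y. g y \<partial>\<nu>)))"

text \<open>The minimum over the empty set is \<open>\<infinity>\<close>.\<close>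

definition mixing_index ::
    "'x measure \<Rightarrow> ((int \<Rightarrow> 'y) \<Rightarrow> 'x set) \<Rightarrow> ((int \<Rightarrow> 'y) \<Rightarrow> 'x \<Rightarrow> 'x measure) \<Rightarrow>
     ((int \<Rightarrow> 'y) \<Rightarrow> 'x measure) \<Rightarrow> real \<Rightarrow> (int \<Rightarrow> 'y) \<Rightarrow> enat" where
  "mixing_index MX X R \<mu> \<epsilon> \<omega> =
     Inf {enat n | n. 1 \<le> n \<and> markov_dist MX X R n \<omega> (\<mu> ((left_shift ^^ n) \<omega>)) \<le> \<epsilon>}"


section \<open>The space $L^p$ for finite $p$\<close>

definition in_Lp :: "'a measure \<Rightarrow> real \<Rightarrow> ('a \<Rightarrow> real) \<Rightarrow> bool" where
  "in_Lp M p f \<longleftrightarrow> f \<in> borel_measurable M \<and> integrable M (\<lambda>x. \<bar>f x\<bar> powr p)"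

definition Lp_norm :: "'a measure \<Rightarrow> real \<Rightarrow> ('a \<Rightarrow> real) \<Rightarrow> real" where
  "Lp_norm M p f = (\<integral>x. \<bar>f x\<bar> powr p \<partial>M) powr (1 / p)"

end

theory Submission
  imports Defs
begin

text \<open>
  If \<open>N\<^sub>\<epsilon>(\<omega>) > N\<close>, then \<open>N\<close> itself fails the defining condition of \<open>N\<^sub>\<epsilon>(\<omega>)\<close>, so the mixing estimate at
  time \<open>N\<close> forces \<open>\<epsilon> < K(\<omega>) \<rho>\<^bsup>N/p\<^esup>\<close>. The probability of this event is bounded by Markov's
  inequality applied to \<open>|K|\<^sup>p\<close>.
\<close>

text \<open>Otherwise \<open>N\<close> would lie in the set whose infimum is
  \<open>mixing_index\<close>; the condition \<open>1 \<le> N\<close> matters because only positive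
  times compete there. An infinite index is covered as well.\<close>

lemma markov_dist_greater_of_mixing_index:
  assumes "mixing_index MX X R \<mu> \<epsilon> \<omega> > enat N" and "1 \<le> N"
  shows "markov_dist MX X R N \<omega> (\<mu> ((left_shift ^^ N) \<omega>)) > \<epsilon>"
proof (rule ccontr)
  assume "\<not> ?thesis"
  then have "mixing_index MX X R \<mu> \<epsilon> \<omega> \<le> enat N"
    unfolding mixing_index_def using assms(2) by (intro Inf_lower) auto
  with assms(1) show False by simp
qed

text \<open>Measurability into the product is checked coordinatewise. The result supplies the
  finiteness of \<open>P\<close> used to compare events below.\<close>

lemma prob_space_sequence_law:
  assumes "prob_space S" and "\<And>j. Y j \<in> S \<rightarrow>\<^sub>M MY"
  shows "prob_space (sequence_law S MY Y)"
proof -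
  have "(\<lambda>s j. Y j s) \<in> S \<rightarrow>\<^sub>M (PiM UNIV (\<lambda>_. MY))"
    using assms(2) by (intro measurable_PiM_single') (auto simp: PiE_def dest: measurable_space)
  with assms(1) show ?thesis
    unfolding sequence_law_def by (rule prob_space.prob_space_distr)
qed

lemma Lp_norm_powr:
  assumes "p \<noteq> 0"
  shows "Lp_norm M p f powr p = (\<integral>x. \<bar>f x\<bar> powr p \<partial>M)"
proof -
  \<comment> \<open>The exponents \<open>1 / p\<close> and \<open>p\<close> cancel to 1, and
    \<open>powr 1\<close> is the identity on nonnegative reals.\<close>
  have "0 \<le> (\<integral>x. \<bar>f x\<bar> powr p \<partial>M)" by simp
  with assms show ?thesis by (simp add: Lp_norm_def powr_powr)
qed

text \<open>Markov's inequality for \<open>\<bar>f x\<bar> powr p\<close> at level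
  \<open>t powr p\<close>: raising to a positive power is strictly increasing on nonnegative reals,
  so the event is unchanged.\<close>

lemma Lp_Markov_inequality:
  assumes "in_Lp M p f" and "0 < p" and "0 < t"
  shows "measure M {x \<in> space M. t \<le> \<bar>f x\<bar>} \<le> Lp_norm M p f powr p * t powr (- p)"
proof -
  have "integrable M (\<lambda>x. \<bar>f x\<bar> powr p)"
    using assms(1) by (simp add: in_Lp_def)
  then have "measure M {x \<in> space M. t powr p \<le> \<bar>f x\<bar> powr p}
      \<le> (\<integral>x. \<bar>f x\<bar> powr p \<partial>M) / t powr p"
    using assms(3) by (intro integral_Markov_inequality_measure[where A = "{}"]) auto
  moreover have "t powr p \<le> \<bar>f x\<bar> powr p \<longleftrightarrow> t \<le> \<bar>f x\<bar>" for x
    using assms(2,3) powr_mono2[of p t "\<bar>f x\<bar>"] powr_less_mono2[of p "\<bar>f x\<bar>" t] by fastforce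
  ultimately show ?thesis
    using assms(2) by (simp add: Lp_norm_powr powr_minus divide_inverse)
qed

theorem theorem4p5:
  fixes S :: "'s measure" and MY :: "'y measure" and Y :: "int \<Rightarrow> 's \<Rightarrow> 'y"
    and P :: "(int \<Rightarrow> 'y) measure"
    and MX :: "'x measure" and X :: "(int \<Rightarrow> 'y) \<Rightarrow> 'x set"
    and R :: "(int \<Rightarrow> 'y) \<Rightarrow> 'x \<Rightarrow> 'x measure"
    and \<mu> :: "(int \<Rightarrow> 'y) \<Rightarrow> 'x measure"
    and K :: "(int \<Rightarrow> 'y) \<Rightarrow> real" and p \<rho> :: real
  assumes "prob_space S"
    and "\<And>j. Y j \<in> S \<rightarrow>\<^sub>M MY"
    and "stationary_sequence S MY Y"
    and "ergodic_sequence S MY Y"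
    and "P = sequence_law S MY Y"
    and "random_state_space P MX X"
    and "random_transition P MX X R"
    and "random_probability P MX X \<mu>"
    and "AE \<omega> in P. \<mu> \<omega> \<bind> R \<omega> = \<mu> (left_shift \<omega>)"
    and "\<And>n. 1 \<le> n \<Longrightarrow>
           (\<lambda>\<omega>. markov_dist MX X R n \<omega> (\<mu> ((left_shift ^^ n) \<omega>))) \<in> borel_measurable P"
    and "1 \<le> p"
    and "0 < \<rho>" and "\<rho> < 1"
    and "in_Lp P p K"
    and "AE \<omega> in P. \<forall>n\<ge>1.
           markov_dist MX X R n \<omega> (\<mu> ((left_shift ^^ n) \<omega>)) \<le> K \<omega> * \<rho> powr (real n / p)"
  shows "\<forall>\<epsilon>>0. \<forall>N\<ge>1.
           measure P {\<omega> \<in> space P. mixing_index MX X R \<mu> \<epsilon> \<omega> > enat N}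
             \<le> Lp_norm P p K powr p * \<epsilon> powr (- p) * \<rho> ^ N"
proof (intro allI impI)
  fix \<epsilon> :: real and N :: nat
  assume \<epsilon>: "0 < \<epsilon>" and N: "1 \<le> N"
  interpret P: prob_space P
    unfolding assms(5) using assms(1,2) by (rule prob_space_sequence_law)
  \<comment> \<open>The level at which
    \<open>\<epsilon> < K \<omega> * \<rho> powr (real N / p)\<close> becomes
    \<open>t < K \<omega>\<close>.\<close>
  define t where "t = \<epsilon> * \<rho> powr (- (real N / p))"
  have t: "0 < t" using \<epsilon> assms(12) by (simp add: t_def)
  have "AE \<omega> in P. mixing_index MX X R \<mu> \<epsilon> \<omega> > enat N \<longrightarrow> t \<le> \<bar>K \<omega>\<bar>"
    using assms(15)
  proof (eventually_elim, intro impI)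
    fix \<omega>
    assume bound: "\<forall>n\<ge>1. markov_dist MX X R n \<omega> (\<mu> ((left_shift ^^ n) \<omega>))
        \<le> K \<omega> * \<rho> powr (real n / p)"
      and "mixing_index MX X R \<mu> \<epsilon> \<omega> > enat N"
    from this(2) N have "\<epsilon> < markov_dist MX X R N \<omega> (\<mu> ((left_shift ^^ N) \<omega>))"
      by (rule markov_dist_greater_of_mixing_index)
    also have "\<dots> \<le> K \<omega> * \<rho> powr (real N / p)"
      using bound N by blast
    finally have "t < K \<omega>"
      using assms(12) by (simp add: t_def powr_minus field_simps)
    then show "t \<le> \<bar>K \<omega>\<bar>" by simp
  qed
  moreover have [measurable]: "K \<in> borel_measurable P"
    using assms(14) by (simp add: in_Lp_def)
  \<comment> \<open>The inclusion of events holds only up to a null set; the comparison of measures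
    then asks that the dominating event be measurable.\<close>
  have "{\<omega> \<in> space P. t \<le> \<bar>K \<omega>\<bar>} \<in> sets P"
    by measurable
  ultimately have "measure P {\<omega> \<in> space P. mixing_index MX X R \<mu> \<epsilon> \<omega> > enat N}
      \<le> measure P {\<omega> \<in> space P. t \<le> \<bar>K \<omega>\<bar>}"
    by (intro P.finite_measure_mono_AE) auto
  also have "\<dots> \<le> Lp_norm P p K powr p * t powr (- p)"
    using assms(11,14) t by (intro Lp_Markov_inequality) auto
  \<comment> \<open>The exponents \<open>- (real N / p)\<close> and \<open>- p\<close> multiply to
    \<open>real N\<close>, and \<open>0 < \<rho>\<close> turns this real power into
    \<open>\<rho> ^ N\<close>.\<close>
  also have "t powr (- p) = \<epsilon> powr (- p) * \<rho> ^ N"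
    using \<epsilon> assms(11,12) by (simp add: t_def powr_mult powr_powr powr_realpow)
  finally show "measure P {\<omega> \<in> space P. mixing_index MX X R \<mu> \<epsilon> \<omega> > enat N}
      \<le> Lp_norm P p K powr p * \<epsilon> powr (- p) * \<rho> ^ N"
    by (simp add: mult.assoc)
qed

end
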